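(* Let $(E,\Vert\cdot\Vert)$ be a normed lattice that is an order dense majorizing vector sublattice of a vector lattice $G$, and let $E^t$, with norm $\Vert\cdot\Vert_t$, be as defined in the context ($E\subseteq E^t\subseteq G$). Suppose that $E$ has order continuous norm. Then: 1. If $E$ is a KB-space, then so is $E^t$. 2. If $E$ is an AL-space, then so is $E^t$.
   Context: All vector lattices (Riesz spaces) are assumed Archimedean. $E^+$ is the set of positive elements of $E$. A vector sublattice $E$ of $G$ is majorizing in $G$ if for each $x\in G$ there is $y\in E$ with $x\le y$; it is order dense in $G$ if for each $0<x\in G$ there is $y\in E$ with $0<y\le x$. $E$ has order continuous norm if $\Vert x_\alpha\Vert\to 0$ for every decreasing net $(x_\alpha)$ in $E$ with $\inf_\alpha x_\alpha=0$. Definition of $E^t$: $E^t$ is a vector sublattice of $G$ with $E\subseteq E^t\subseteq G$ such that every $x\in E^t$ satisfies $$\inf\{\Vert y\Vert:\ y\in E^+,\ |x|\le y\}=\sup\{\Vert z\Vert:\ z\in E^+,\ z\le |x|\}.$$ The common value is denoted $\Vert x\Vert_t$; $(E^t,\Vert\cdot\Vert_t)$ is a normed lattice. ($E^t$ is not unique; the statement concerns any such $E^t$.) A KB-space is a Banach lattice in which every increasing norm bounded sequence of positive elements is norm convergent. An AL-space is a Banach lattice in which $\Vert x+y\Vert=\Vert x\Vert+\Vert y\Vert$ for all $x,y\ge 0$ with $x\wedge y=0$. *)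

theory Defs
  imports Complex_Main "HOL-Library.Lattice_Algebras"
begin

text \<open>An ambient Archimedean vector lattice is a type of the following class. Its vector
  sublattices are sets, and the norm of such a sublattice is a real-valued function on the ambient
  type of which only the values on the sublattice matter.\<close>

class archimedean_vector_lattice = ordered_real_vector + lattice_ab_group_add_abs +
  assumes archimedean: "(\<And>n::nat. real n *\<^sub>R x \<le> y) \<Longrightarrow> x \<le> 0"

definition vector_sublattice :: "'a::archimedean_vector_lattice set \<Rightarrow> bool" where
  "vector_sublattice E \<longleftrightarrow>
     subspace E \<and> (\<forall>x\<in>E. \<forall>y\<in>E. sup x y \<in> E \<and> inf x y \<in> E)"

definition majorizing :: "'a::archimedean_vector_lattice set \<Rightarrow> bool" where
  "majorizing E \<longleftrightarrow> (\<forall>x. \<exists>y\<in>E. x \<le> y)"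

definition order_dense :: "'a::archimedean_vector_lattice set \<Rightarrow> bool" where
  "order_dense E \<longleftrightarrow> (\<forall>x>0. \<exists>y\<in>E. 0 < y \<and> y \<le> x)"

definition normed_lattice :: "'a::archimedean_vector_lattice set \<Rightarrow> ('a \<Rightarrow> real) \<Rightarrow> bool" where
  "normed_lattice E N \<longleftrightarrow> vector_sublattice E \<and>
     (\<forall>x\<in>E. 0 \<le> N x) \<and>
     (\<forall>x\<in>E. N x = 0 \<longleftrightarrow> x = 0) \<and>
     (\<forall>x\<in>E. \<forall>a. N (a *\<^sub>R x) = \<bar>a\<bar> * N x) \<and>
     (\<forall>x\<in>E. \<forall>y\<in>E. N (x + y) \<le> N x + N y) \<and>
     (\<forall>x\<in>E. \<forall>y\<in>E. \<bar>x\<bar> \<le> \<bar>y\<bar> \<longrightarrow> N x \<le> N y)"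

definition directed_on :: "'i set \<Rightarrow> ('i \<Rightarrow> 'i \<Rightarrow> bool) \<Rightarrow> bool" where
  "directed_on I le \<longleftrightarrow> I \<noteq> {} \<and>
     (\<forall>i\<in>I. le i i) \<and>
     (\<forall>i\<in>I. \<forall>j\<in>I. \<forall>k\<in>I. le i j \<longrightarrow> le j k \<longrightarrow> le i k) \<and>
     (\<forall>i\<in>I. \<forall>j\<in>I. \<exists>k\<in>I. le i k \<and> le j k)"

definition decreasing_net_in ::
  "'a::archimedean_vector_lattice set \<Rightarrow> 'i set \<Rightarrow> ('i \<Rightarrow> 'i \<Rightarrow> bool) \<Rightarrow> ('i \<Rightarrow> 'a) \<Rightarrow> bool" where
  "decreasing_net_in E I le x \<longleftrightarrow> directed_on I le \<and>
     (\<forall>i\<in>I. x i \<in> E) \<and> (\<forall>i\<in>I. \<forall>j\<in>I. le i j \<longrightarrow> x j \<le> x i)"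

definition has_inf_in ::
  "'a::archimedean_vector_lattice set \<Rightarrow> 'a set \<Rightarrow> 'a \<Rightarrow> bool" where
  "has_inf_in E A m \<longleftrightarrow> m \<in> E \<and> (\<forall>a\<in>A. m \<le> a) \<and> (\<forall>b\<in>E. (\<forall>a\<in>A. b \<le> a) \<longrightarrow> b \<le> m)"

definition net_tendsto_0 :: "'i set \<Rightarrow> ('i \<Rightarrow> 'i \<Rightarrow> bool) \<Rightarrow> ('i \<Rightarrow> real) \<Rightarrow> bool" where
  "net_tendsto_0 I le r \<longleftrightarrow> (\<forall>\<epsilon>>0. \<exists>i\<in>I. \<forall>j\<in>I. le i j \<longrightarrow> \<bar>r j\<bar> < \<epsilon>)"

text \<open>A definition cannot quantify over index types, so the nets are indexed by subsets of the
  ambient type. This is no restriction, as the lemma after the definition shows.\<close>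

definition order_continuous_norm ::
  "'a::archimedean_vector_lattice set \<Rightarrow> ('a \<Rightarrow> real) \<Rightarrow> bool" where
  "order_continuous_norm E N \<longleftrightarrow>
     (\<forall>(I :: 'a set) le x. decreasing_net_in E I le x \<longrightarrow> has_inf_in E (x ` I) 0 \<longrightarrow>
        net_tendsto_0 I le (\<lambda>i. N (x i)))"

lemma order_continuous_norm_any_index:
  fixes E :: "'a::archimedean_vector_lattice set" and I :: "'i set"
  assumes oc: "order_continuous_norm E N"
    and x: "decreasing_net_in E I le x" and inf0: "has_inf_in E (x ` I) 0"
  shows "net_tendsto_0 I le (\<lambda>i. N (x i))"
proof -
  have xE: "x i \<in> E" if "i \<in> I" for i
    using x that by (simp add: decreasing_net_in_def)
  have antitone: "x j \<le> x i" if "i \<in> I" "j \<in> I" "le i j" for i j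
    using x that by (simp add: decreasing_net_in_def)
  have "directed_on I le"
    using x by (simp add: decreasing_net_in_def)
  then have ne: "I \<noteq> {}" and "\<forall>i\<in>I. \<forall>j\<in>I. \<exists>k\<in>I. le i k \<and> le j k"
    unfolding directed_on_def by argo+
  then have up: "\<exists>k\<in>I. le i k \<and> le j k" if "i \<in> I" "j \<in> I" for i j
    using that by blast
  have dir: "\<exists>k\<in>I. x k \<le> x i \<and> x k \<le> x j" if "i \<in> I" "j \<in> I" for i j
    using up[OF that] antitone that by blast
  have "decreasing_net_in E (x ` I) (\<lambda>a b. b \<le> a) (\<lambda>a. a)"
    unfolding decreasing_net_in_def directed_on_def
    using ne xE dir by (fastforce intro: order_trans)
  moreover have "has_inf_in E ((\<lambda>a. a) ` x ` I) 0"
    using inf0 by simp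
  ultimately have lim: "net_tendsto_0 (x ` I) (\<lambda>a b. b \<le> a) (\<lambda>a. N a)"
    using oc unfolding order_continuous_norm_def by blast
  show ?thesis
    unfolding net_tendsto_0_def
  proof (intro allI impI)
    fix \<epsilon> :: real
    assume "0 < \<epsilon>"
    then obtain i where i: "i \<in> I" "\<forall>a\<in>x ` I. a \<le> x i \<longrightarrow> \<bar>N a\<bar> < \<epsilon>"
      using lim unfolding net_tendsto_0_def by blast
    then show "\<exists>i\<in>I. \<forall>j\<in>I. le i j \<longrightarrow> \<bar>N (x j)\<bar> < \<epsilon>"
      using antitone by blast
  qed
qed

definition banach_lattice :: "'a::archimedean_vector_lattice set \<Rightarrow> ('a \<Rightarrow> real) \<Rightarrow> bool" where
  "banach_lattice E N \<longleftrightarrow> normed_lattice E N \<and>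
     (\<forall>x :: nat \<Rightarrow> 'a. (\<forall>n. x n \<in> E) \<longrightarrow>
        (\<forall>\<epsilon>>0. \<exists>M. \<forall>m\<ge>M. \<forall>n\<ge>M. N (x m - x n) < \<epsilon>) \<longrightarrow>
        (\<exists>l\<in>E. (\<lambda>n. N (x n - l)) \<longlonglongrightarrow> 0))"

definition KB_space :: "'a::archimedean_vector_lattice set \<Rightarrow> ('a \<Rightarrow> real) \<Rightarrow> bool" where
  "KB_space E N \<longleftrightarrow> banach_lattice E N \<and>
     (\<forall>x :: nat \<Rightarrow> 'a. (\<forall>n. x n \<in> E \<and> 0 \<le> x n) \<longrightarrow> incseq x \<longrightarrow> (\<exists>C. \<forall>n. N (x n) \<le> C) \<longrightarrow>
        (\<exists>l\<in>E. (\<lambda>n. N (x n - l)) \<longlonglongrightarrow> 0))"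

definition AL_space :: "'a::archimedean_vector_lattice set \<Rightarrow> ('a \<Rightarrow> real) \<Rightarrow> bool" where
  "AL_space E N \<longleftrightarrow> banach_lattice E N \<and>
     (\<forall>x\<in>E. \<forall>y\<in>E. 0 \<le> x \<longrightarrow> 0 \<le> y \<longrightarrow> inf x y = 0 \<longrightarrow> N (x + y) = N x + N y)"

text \<open>If \<open>E\<close> is a majorizing normed lattice, the two sets of real numbers below are nonempty, the
  first is bounded below and the second is bounded above, so that \<open>Inf\<close> and \<open>Sup\<close> have their usual
  meaning.\<close>

definition upper_norm ::
  "'a::archimedean_vector_lattice set \<Rightarrow> ('a \<Rightarrow> real) \<Rightarrow> 'a \<Rightarrow> real" where
  "upper_norm E N x = Inf {N y |y. y \<in> E \<and> 0 \<le> y \<and> \<bar>x\<bar> \<le> y}"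

definition lower_norm ::
  "'a::archimedean_vector_lattice set \<Rightarrow> ('a \<Rightarrow> real) \<Rightarrow> 'a \<Rightarrow> real" where
  "lower_norm E N x = Sup {N z |z. z \<in> E \<and> 0 \<le> z \<and> z \<le> \<bar>x\<bar>}"

text \<open>The sublattice \<open>E\<^sup>t\<close> is not unique, so it is given by a predicate; its norm is the common
  value of \<open>upper_norm\<close> and \<open>lower_norm\<close>.\<close>

definition is_Et ::
  "'a::archimedean_vector_lattice set \<Rightarrow> ('a \<Rightarrow> real) \<Rightarrow> 'a set \<Rightarrow> bool" where
  "is_Et E N Et \<longleftrightarrow> vector_sublattice Et \<and> E \<subseteq> Et \<and>
     (\<forall>x\<in>Et. upper_norm E N x = lower_norm E N x)"

abbreviation norm_t ::
  "'a::archimedean_vector_lattice set \<Rightarrow> ('a \<Rightarrow> real) \<Rightarrow> 'a \<Rightarrow> real" where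
  "norm_t \<equiv> upper_norm"

end

theory Submission
  imports Defs
begin

text \<open>An order continuous Banach lattice is Dedekind complete, so it cannot be properly contained in
  \<open>G\<close> as an order dense majorizing sublattice: \<open>E = E\<^sup>t = G\<close>, and the two norms agree. Concretely,
  for \<open>x\<close> in \<open>G\<close> the differences \<open>z - y\<close> with \<open>y, z\<close> in \<open>E\<close> and \<open>y \<le> x \<le> z\<close> decrease to \<open>0\<close>. By
  order continuity some of them have arbitrarily small norm, so suitable \<open>y\<close> form a Cauchy
  sequence, and its limit is \<open>x\<close>.\<close>

text \<open>If the claim failed, order density would put some \<open>w > 0\<close> of
  \<open>E\<close> below the gap \<open>x - inf u x\<close>. Adding \<open>w\<close> to an element
  of \<open>E\<close> below \<open>x\<close> gives another such element, so all multiples of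
  \<open>w\<close> would be bounded, against the Archimedean property.\<close>

lemma order_dense_upper_bound:
  fixes E :: "'a::archimedean_vector_lattice set"
  assumes E: "subspace E" and dense: "order_dense E" and major: "majorizing E"
    and u: "\<And>y. y \<in> E \<Longrightarrow> y \<le> x \<Longrightarrow> y \<le> u"
  shows "x \<le> u"
proof (rule ccontr)
  assume "\<not> x \<le> u"
  then have "inf u x < x"
    by (metis inf.cobounded1 inf.cobounded2 less_le)
  then have "0 < x - inf u x"
    by (simp only: diff_gt_0_iff_gt)
  then obtain w where w: "w \<in> E" "0 < w" "w \<le> x - inf u x"
    using dense unfolding order_dense_def by blast
  \<comment> \<open>The iteration needs an element of \<open>E\<close> below \<open>x\<close> to
    start from; majorizing \<open>- x\<close> by \<open>v\<close> supplies
    \<open>- v\<close>.\<close>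
  obtain v where v: "v \<in> E" "- x \<le> v"
    using major unfolding majorizing_def by blast
  have step: "y + w \<le> x" if "y \<in> E" "y \<le> x" for y
  proof -
    have "y \<le> inf u x"
      using u that by simp
    then have "y + w \<le> inf u x + (x - inf u x)"
      using w by (intro add_mono)
    then show ?thesis
      by (simp only: add_diff_eq add_diff_cancel_left')
  qed
  have iterate: "- v + real n *\<^sub>R w \<in> E \<and> - v + real n *\<^sub>R w \<le> x" for n
  proof (induction n)
    case 0
    show ?case
      using v E by (simp add: subspace_neg minus_le_iff)
  next
    case (Suc n)
    have "- v + real (Suc n) *\<^sub>R w = - v + real n *\<^sub>R w + w"
      by (simp add: algebra_simps)
    then show ?case
      using Suc step E w by (metis subspace_add)
  qed
  have "real n *\<^sub>R w \<le> x + v" for n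
    using iterate[of n] by (simp add: algebra_simps)
  then have "w \<le> 0"
    by (rule archimedean)
  then show False
    using w by simp
qed

lemma order_dense_lower_bound:
  fixes E :: "'a::archimedean_vector_lattice set"
  assumes E: "subspace E" and "order_dense E" and "majorizing E"
    and l: "\<And>z. z \<in> E \<Longrightarrow> x \<le> z \<Longrightarrow> l \<le> z"
  shows "l \<le> x"
proof -
  have "- x \<le> - l"
  proof (rule order_dense_upper_bound[OF assms(1-3)])
    fix y assume "y \<in> E" "y \<le> - x"
    then show "y \<le> - l"
      using l[of "- y"] subspace_neg[OF E] by (simp add: le_minus_iff)
  qed
  then show ?thesis by simp
qed

text \<open>The differences \<open>z - y\<close> form a downward directed subset of
  \<open>E\<close>. Its infimum in \<open>E\<close> is \<open>0\<close> because \<open>x\<close> is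
  both the supremum of the elements of \<open>E\<close> below it and the infimum of those above it.
  So order continuity applies although \<open>x\<close> itself may lie outside
  \<open>E\<close>.\<close>

lemma order_continuous_bracket:
  fixes E :: "'a::archimedean_vector_lattice set"
  assumes E: "vector_sublattice E" and dense: "order_dense E" and major: "majorizing E"
    and oc: "order_continuous_norm E N" and "0 < e"
  obtains y z where "y \<in> E" "z \<in> E" "y \<le> x" "x \<le> z" "N (z - y) < e"
proof -
  have sub: "subspace E"
    and lat: "\<And>a b. a \<in> E \<Longrightarrow> b \<in> E \<Longrightarrow> sup a b \<in> E \<and> inf a b \<in> E"
    using E by (auto simp: vector_sublattice_def)
  define D where "D = {z - y |y z. y \<in> E \<and> z \<in> E \<and> y \<le> x \<and> x \<le> z}"
  obtain z0 where z0: "z0 \<in> E" "x \<le> z0"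
    using major unfolding majorizing_def by blast
  obtain v where v: "v \<in> E" "- x \<le> v"
    using major unfolding majorizing_def by blast
  have "- v \<in> E" "- v \<le> x"
    using v sub by (auto simp: subspace_neg minus_le_iff)
  then have nonempty: "D \<noteq> {}"
    using z0 unfolding D_def by blast
  have directed: "\<exists>c\<in>D. c \<le> a \<and> c \<le> b" if ab: "a \<in> D" "b \<in> D" for a b
  proof -
    obtain y z y' z' where
      y: "a = z - y" "y \<in> E" "z \<in> E" "y \<le> x" "x \<le> z" and
      y': "b = z' - y'" "y' \<in> E" "z' \<in> E" "y' \<le> x" "x \<le> z'"
      using ab unfolding D_def by blast
    have "inf z z' - sup y y' \<in> D"
      using lat[OF y(2) y'(2)] lat[OF y(3) y'(3)] y y' unfolding D_def by fastforce
    moreover have "inf z z' - sup y y' \<le> a" "inf z z' - sup y y' \<le> b"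
      unfolding y(1) y'(1) by (rule diff_mono; simp)+
    ultimately show ?thesis by blast
  qed
  have "D \<subseteq> E"
    using sub by (auto simp: D_def subspace_diff)
  then have net: "decreasing_net_in E D (\<lambda>a b. b \<le> a) (\<lambda>a. a)"
    unfolding decreasing_net_in_def directed_on_def
    using nonempty directed by (auto intro: order_trans)
  have "has_inf_in E ((\<lambda>a. a) ` D) 0"
    unfolding has_inf_in_def
  proof (intro conjI ballI impI)
    show "0 \<in> E"
      using sub by (rule subspace_0)
    show "0 \<le> a" if "a \<in> (\<lambda>a. a) ` D" for a
      using that by (auto simp: D_def intro: order_trans)
  next
    fix b assume "b \<in> E" and b: "\<forall>a\<in>(\<lambda>a. a) ` D. b \<le> a"
    have gap: "y \<le> z - b" if "y \<in> E" "z \<in> E" "y \<le> x" "x \<le> z" for y z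
    proof -
      have "z - y \<in> D"
        using that unfolding D_def by blast
      then have "b \<le> z - y"
        using b by simp
      then show ?thesis
        by (simp add: algebra_simps)
    qed
    \<comment> \<open>Varying \<open>y\<close> for a fixed \<open>z\<close> removes \<open>y\<close>
      from the inequality; varying \<open>z\<close> afterwards removes \<open>z\<close> and leaves
      \<open>x + b \<le> x\<close>.\<close>
    have "x \<le> z - b" if "z \<in> E" "x \<le> z" for z
      using order_dense_upper_bound[OF sub dense major] gap that by blast
    then have "x + b \<le> x"
      using order_dense_lower_bound[OF sub dense major, of x "x + b"]
      by (simp add: algebra_simps)
    then show "b \<le> 0" by simp
  qed
  with net oc have "net_tendsto_0 D (\<lambda>a b. b \<le> a) (\<lambda>a. N a)"
    unfolding order_continuous_norm_def by blast
  then obtain a where "a \<in> D" "\<bar>N a\<bar> < e"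
    using \<open>0 < e\<close> unfolding net_tendsto_0_def by blast
  then show thesis
    using that unfolding D_def by fastforce
qed

lemma order_continuous_banach_lattice_eq_UNIV:
  fixes E :: "'a::archimedean_vector_lattice set"
  assumes banach: "banach_lattice E N" and dense: "order_dense E" and major: "majorizing E"
    and oc: "order_continuous_norm E N"
  shows "E = UNIV"
proof -
  have NL: "normed_lattice E N"
    using banach by (simp add: banach_lattice_def)
  then have E: "vector_sublattice E"
    and N0: "\<And>a. a \<in> E \<Longrightarrow> 0 \<le> N a" "\<And>a. a \<in> E \<Longrightarrow> N a = 0 \<Longrightarrow> a = 0"
    and tri: "\<And>a b. a \<in> E \<Longrightarrow> b \<in> E \<Longrightarrow> N (a + b) \<le> N a + N b"
    and mono: "\<And>a b. a \<in> E \<Longrightarrow> b \<in> E \<Longrightarrow> \<bar>a\<bar> \<le> \<bar>b\<bar> \<Longrightarrow> N a \<le> N b"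
    by (simp_all add: normed_lattice_def)
  have sub: "subspace E" and abs_in: "\<And>a. a \<in> E \<Longrightarrow> \<bar>a\<bar> \<in> E"
    using E by (auto simp: vector_sublattice_def abs_lattice subspace_neg)
  have "x \<in> E" for x
  proof -
    \<comment> \<open>\<open>Suc\<close> keeps the bound positive at \<open>n = 0\<close>, where
      \<open>inverse 0\<close> would be \<open>0\<close>.\<close>
    have "\<exists>y z. y \<in> E \<and> z \<in> E \<and> y \<le> x \<and> x \<le> z \<and> N (z - y) < inverse (real (Suc n))" for n
      by (rule order_continuous_bracket[OF E dense major oc, of "inverse (real (Suc n))" x]) auto
    then obtain y z where y: "\<And>n. y n \<in> E" "\<And>n. y n \<le> x" and z: "\<And>n. z n \<in> E" "\<And>n. x \<le> z n"
      and small: "\<And>n. N (z n - y n) < inverse (real (Suc n))"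
      by metis
    have gap_in: "z n - y n \<in> E" for n
      using y z sub by (simp add: subspace_diff)
    have gap_nonneg: "0 \<le> z n - y n" for n
      using y(2)[of n] z(2)[of n] by (auto intro: order_trans)
    have cauchy: "N (y m - y n) < inverse (real (Suc m)) + inverse (real (Suc n))" for m n
    proof -
      \<comment> \<open>Since \<open>y j \<le> x \<le> z k\<close>, the left side is at most the
        single gap \<open>z k - y k\<close>. The other gap is added to make the bound symmetric, so
        that both orders of \<open>m\<close> and \<open>n\<close> together bound the absolute
        value.\<close>
      have le: "y j - y k \<le> (z m - y m) + (z n - y n)" if "(j, k) \<in> {(m, n), (n, m)}" for j k
      proof -
        have "y j - y k \<le> z k - y k"
          using y(2)[of j] z(2)[of k] by (auto intro: diff_mono order_trans)
        also have "\<dots> \<le> (z m - y m) + (z n - y n)"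
          using that gap_nonneg[of m] gap_nonneg[of n]
          by (auto simp: le_add_same_cancel1 le_add_same_cancel2)
        finally show ?thesis .
      qed
      have "\<bar>y m - y n\<bar> \<le> (z m - y m) + (z n - y n)"
        using le[of m n] le[of n m] by (intro abs_leI) auto
      also have "\<dots> \<le> \<bar>(z m - y m) + (z n - y n)\<bar>"
        by (rule abs_ge_self)
      finally have "N (y m - y n) \<le> N ((z m - y m) + (z n - y n))"
        by (intro mono) (auto intro: subspace_diff[OF sub] subspace_add[OF sub] y z)
      also have "\<dots> \<le> N (z m - y m) + N (z n - y n)"
        using gap_in by (intro tri)
      finally show ?thesis
        using small[of m] small[of n] by linarith
    qed
    have "\<exists>M. \<forall>m\<ge>M. \<forall>n\<ge>M. N (y m - y n) < \<epsilon>" if "0 < \<epsilon>" for \<epsilon> :: real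
    proof -
      obtain M where M: "inverse (real (Suc M)) < \<epsilon> / 2"
        using reals_Archimedean half_gt_zero[OF \<open>0 < \<epsilon>\<close>] by blast
      have "inverse (real (Suc n)) < \<epsilon> / 2" if "M \<le> n" for n
      proof -
        have "inverse (real (Suc n)) \<le> inverse (real (Suc M))"
          using that by (intro le_imp_inverse_le) auto
        then show ?thesis using M by linarith
      qed
      then have "N (y m - y n) < \<epsilon>" if "M \<le> m" "M \<le> n" for m n
        using cauchy[of m n] that by (smt (verit) field_sum_of_halves)
      then show ?thesis by blast
    qed
    then obtain l where l: "l \<in> E" "(\<lambda>n. N (y n - l)) \<longlonglongrightarrow> 0"
      using banach y(1) unfolding banach_lattice_def by blast
    \<comment> \<open>Nothing is assumed about \<open>N\<close> outside \<open>E\<close>, and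
      \<open>x - l\<close> is not yet known to lie in \<open>E\<close>. If it is nonzero, order
      density places a positive \<open>w\<close> of \<open>E\<close> below its absolute value, and
      \<open>N w\<close> is then bounded by a null sequence.\<close>
    have "x = l"
    proof (rule ccontr)
      assume "x \<noteq> l"
      then have "0 < \<bar>x - l\<bar>" by simp
      then obtain w where w: "w \<in> E" "0 < w" "w \<le> \<bar>x - l\<bar>"
        using dense unfolding order_dense_def by blast
      have bound: "N w \<le> inverse (real (Suc n)) + N (y n - l)" for n
      proof -
        have yl: "y n - l \<in> E"
          using y l sub by (simp add: subspace_diff)
        have "\<bar>x - l\<bar> \<le> \<bar>x - y n\<bar> + \<bar>y n - l\<bar>"
          using abs_triangle_ineq[of "x - y n" "y n - l"] by simp
        \<comment> \<open>Here \<open>\<bar>x - y n\<bar>\<close> is just \<open>x - y n\<close>;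
          replacing \<open>x\<close> by \<open>z n\<close> yields a bound in \<open>E\<close>, where
          \<open>N\<close> is monotone.\<close>
        also have "\<dots> \<le> (z n - y n) + \<bar>y n - l\<bar>"
          using y(2)[of n] z(2)[of n] by simp
        finally have "w \<le> (z n - y n) + \<bar>y n - l\<bar>"
          using w by (auto intro: order_trans)
        then have "\<bar>w\<bar> \<le> \<bar>(z n - y n) + \<bar>y n - l\<bar>\<bar>"
          using w by (simp add: gap_nonneg[simplified])
        then have "N w \<le> N ((z n - y n) + \<bar>y n - l\<bar>)"
          using w gap_in abs_in[OF yl] by (intro mono) (auto intro: subspace_add[OF sub])
        also have "\<dots> \<le> N (z n - y n) + N \<bar>y n - l\<bar>"
          using gap_in abs_in[OF yl] by (intro tri)
        also have "N \<bar>y n - l\<bar> \<le> N (y n - l)"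
          using abs_in[OF yl] yl by (intro mono) auto
        finally show ?thesis
          using small[of n] by linarith
      qed
      have "(\<lambda>n. inverse (real (Suc n)) + N (y n - l)) \<longlonglongrightarrow> 0 + 0"
        using LIMSEQ_inverse_real_of_nat l(2) by (rule tendsto_add)
      then have "N w \<le> 0"
        using bound by (intro LIMSEQ_le_const) auto
      then show False
        using N0[of w] w by simp
    qed
    then show ?thesis
      using l by simp
  qed
  then show ?thesis by blast
qed

text \<open>The infimum is attained at \<open>\<bar>x\<bar>\<close>, which is itself an admissible
  majorant in \<open>E\<close> and has the same norm as \<open>x\<close>.\<close>

lemma upper_norm_eq_norm:
  fixes E :: "'a::archimedean_vector_lattice set"
  assumes NL: "normed_lattice E N" and x: "x \<in> E"
  shows "upper_norm E N x = N x"
proof -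
  have mono: "\<And>a b. a \<in> E \<Longrightarrow> b \<in> E \<Longrightarrow> \<bar>a\<bar> \<le> \<bar>b\<bar> \<Longrightarrow> N a \<le> N b"
    using NL by (simp add: normed_lattice_def)
  have abs_in: "\<bar>x\<bar> \<in> E"
    using NL x by (auto simp: normed_lattice_def vector_sublattice_def abs_lattice subspace_neg)
  then have "N \<bar>x\<bar> = N x"
    using x by (intro antisym mono) auto
  then show ?thesis
    unfolding upper_norm_def using abs_in x mono
    by (intro cInf_eq_minimum) (auto intro!: exI[of _ "\<bar>x\<bar>"])
qed

theorem theorem3:
  fixes E Et :: "'a::archimedean_vector_lattice set" and N :: "'a \<Rightarrow> real"
  assumes "normed_lattice E N"
    and "order_dense E" and "majorizing E"
    and "is_Et E N Et"
    and "order_continuous_norm E N"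
  shows "(KB_space E N \<longrightarrow> KB_space Et (norm_t E N)) \<and>
         (AL_space E N \<longrightarrow> AL_space Et (norm_t E N))"
proof -
  \<comment> \<open>Both kinds of spaces are Banach lattices by definition, so this equality settles
    both claims. The norms agree as functions on the whole type because \<open>E\<close> is
    everything.\<close>
  have "Et = E \<and> norm_t E N = N" if "banach_lattice E N"
  proof -
    have E: "E = UNIV"
      using order_continuous_banach_lattice_eq_UNIV that assms by blast
    then have "Et = E"
      using assms(4) by (auto simp: is_Et_def)
    moreover have "norm_t E N = N"
      using upper_norm_eq_norm[OF assms(1)] E by auto
    ultimately show ?thesis by blast
  qed
  then show ?thesis
    by (metis KB_space_def AL_space_def)
qed

end
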